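(* The group $\Gamma=\langle a,b\mid bab^{-1}=a^{-2}\rangle$ is a finitely generated group which admits an isolated left-ordering whose positive cone is not finitely generated as a semigroup.
   Context: A left-ordering on a group $\Gamma$ is a total order $\preceq$ on $\Gamma$ such that $\gamma_1\prec\gamma_2$ implies $\gamma_3\gamma_1\prec\gamma_3\gamma_2$ for all $\gamma_1,\gamma_2,\gamma_3\in\Gamma$. Its positive cone is the semigroup $P_\preceq=\{\gamma\in\Gamma : \gamma\succ id\}$. A left-ordering $\preceq$ of $\Gamma$ is called isolated if there is a finite family $\{\gamma_1,\ldots,\gamma_n\}\subset\Gamma$ such that $\preceq$ is the only left-ordering of $\Gamma$ with $\gamma_i\succ id$ for $1\le i\le n$. *)

theory Defs
  imports "HOL-Algebra.Generated_Groups" "HOL.Hull"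
begin

datatype 'g letter = Gen 'g | Inv 'g

text \<open>\<^term>\<open>cancels u v\<close>: the word \<^term>\<open>v\<close> arises from \<^term>\<open>u\<close> by deleting one adjacent
  pair of mutually inverse letters.\<close>

inductive cancels :: "'g letter list \<Rightarrow> 'g letter list \<Rightarrow> bool" where
  "cancels (u @ [Gen x, Inv x] @ v) (u @ v)"
| "cancels (u @ [Inv x, Gen x] @ v) (u @ v)"

definition free_equiv :: "('g letter list \<times> 'g letter list) set" where
  "free_equiv = {(u, v). equivclp cancels u v}"

definition word_class :: "'g letter list \<Rightarrow> 'g letter list set" where
  "word_class w = free_equiv `` {w}"

text \<open>The free group on the set of all elements of the type of generators; its elements are
  words modulo free cancellation.\<close>

definition free_group :: "'g letter list set monoid" where
  "free_group =
    \<lparr>carrier = UNIV // free_equiv,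
     mult = (\<lambda>X Y. \<Union>u\<in>X. \<Union>v\<in>Y. word_class (u @ v)),
     one = word_class []\<rparr>"

definition normal_closure :: "('a, 'b) monoid_scheme \<Rightarrow> 'a set \<Rightarrow> 'a set" where
  "normal_closure G R = (\<lambda>N. N \<lhd> G) hull R"

text \<open>A pair \<^term>\<open>(u, v)\<close> in \<^term>\<open>R\<close> stands for the defining relation \<open>u = v\<close>.\<close>

definition presented_group ::
    "('g letter list \<times> 'g letter list) set \<Rightarrow> 'g letter list set set monoid" where
  "presented_group R =
    free_group Mod normal_closure free_group
      ((\<lambda>(u, v). word_class u \<otimes>\<^bsub>free_group\<^esub> inv\<^bsub>free_group\<^esub> word_class v) ` R)"

datatype gen = gen_a | gen_b

definition Gamma :: "gen letter list set set monoid" where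
  "Gamma = presented_group {([Gen gen_b, Gen gen_a, Inv gen_b], [Inv gen_a, Inv gen_a])}"

definition finitely_generated_group :: "('a, 'b) monoid_scheme \<Rightarrow> bool" where
  "finitely_generated_group G \<longleftrightarrow>
    group G \<and> (\<exists>S. finite S \<and> S \<subseteq> carrier G \<and> generate G S = carrier G)"

definition semigroup_generated :: "('a, 'b) monoid_scheme \<Rightarrow> 'a set \<Rightarrow> 'a set" where
  "semigroup_generated G S = (\<lambda>T. \<forall>x\<in>T. \<forall>y\<in>T. x \<otimes>\<^bsub>G\<^esub> y \<in> T) hull S"

definition finitely_generated_semigroup :: "('a, 'b) monoid_scheme \<Rightarrow> 'a set \<Rightarrow> bool" where
  "finitely_generated_semigroup G P \<longleftrightarrow>
    (\<exists>S. finite S \<and> S \<subseteq> P \<and> semigroup_generated G S = P)"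

text \<open>An ordering is given as the set \<^term>\<open>r\<close> of pairs \<^term>\<open>(x, y)\<close> with \<open>x \<preceq> y\<close>.\<close>

definition left_ordering :: "('a, 'b) monoid_scheme \<Rightarrow> 'a rel \<Rightarrow> bool" where
  "left_ordering G r \<longleftrightarrow>
    linear_order_on (carrier G) r \<and>
    (\<forall>x\<in>carrier G. \<forall>y\<in>carrier G. \<forall>z\<in>carrier G.
      (x, y) \<in> r - Id \<longrightarrow> (z \<otimes>\<^bsub>G\<^esub> x, z \<otimes>\<^bsub>G\<^esub> y) \<in> r - Id)"

definition positive_cone :: "('a, 'b) monoid_scheme \<Rightarrow> 'a rel \<Rightarrow> 'a set" where
  "positive_cone G r = {x \<in> carrier G. (\<one>\<^bsub>G\<^esub>, x) \<in> r - Id}"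

definition isolated_left_ordering :: "('a, 'b) monoid_scheme \<Rightarrow> 'a rel \<Rightarrow> bool" where
  "isolated_left_ordering G r \<longleftrightarrow>
    left_ordering G r \<and>
    (\<exists>F. finite F \<and> F \<subseteq> carrier G \<and> F \<subseteq> positive_cone G r \<and>
      (\<forall>r'. left_ordering G r' \<and> F \<subseteq> positive_cone G r' \<longrightarrow> r' = r))"

end

theory Submission
  imports Defs Complex_Main
begin

text \<open>The relation says that \<open>b\<close> acts on \<open>a\<close> by conjugation as multiplication by \<open>-2\<close>, so the group is
  a semidirect product of \<open>\<int>[1/2]\<close> by \<open>\<int>\<close>, where the generator of \<open>\<int>\<close> multiplies \<open>\<int>[1/2]\<close> by \<open>-2\<close>. Write \<open>(x, n)\<close> for its
  elements, with \<open>a = (1, 0)\<close> and \<open>b = (0, 1)\<close>; equivalently, \<open>(x, n)\<close> is the affine map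
  \<open>t \<mapsto> x + (-2)\<^sup>n t\<close>. The lexicographic ordering that looks at \<open>n\<close> first has positive cone
  \<open>P = {(x, n). n > 0 \<or> n = 0 \<and> x > 0}\<close>.

  The ordering is isolated, and \<open>{a, b}\<close> is a witness, because every positive cone \<open>Q\<close> that contains
  \<open>a\<close> and \<open>b\<close> contains \<open>P\<close> (lemma \<open>cone_least\<close>), and no positive cone contains another one properly
  (lemma \<open>group_cone_eqI\<close>). If \<open>x > 0\<close>, then some power \<open>(2\<^sup>k x, 0)\<close> of \<open>(x, 0)\<close> is a positive power of
  \<open>a\<close>; as \<open>Q\<close> is closed under square roots, \<open>(x, 0) \<in> Q\<close>. For \<open>n > 0\<close> and \<open>x \<ge> 0\<close>, the element \<open>(x, n)\<close>
  is \<open>(x, 0) b\<^sup>n\<close>. For \<open>n > 0\<close> and \<open>x < 0\<close>, it is \<open>b (-x/2, 0) b\<^sup>n\<^sup>-\<^sup>1\<close>, and here it matters that \<open>b\<close>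
  reverses the sign of \<open>x\<close>: for the multiplier \<open>2\<close> instead of \<open>-2\<close> the sign of \<open>(x, n)\<close> would not be
  determined by the signs of \<open>a\<close> and \<open>b\<close>.

  The cone \<open>P\<close> is not finitely generated, because a product of elements of \<open>P\<close> has \<open>n = 0\<close> only if all
  its factors do. So the positive part of \<open>\<int>[1/2]\<close> would be generated by the finitely many generators
  with \<open>n = 0\<close>, whose denominators are bounded (lemma \<open>cone_not_finitely_generated\<close>).

  The map from the presented group to the pairs \<open>(x, n)\<close> comes from von Dyck's theorem
  (lemma \<open>presented_group_hom\<close>). It is injective because each element of the presented group has the
  form \<open>b\<^sup>-\<^sup>k a\<^sup>m b\<^sup>l\<close> (lemma \<open>normal_form_exists\<close>), and \<open>x\<close> and \<open>n\<close> both vanish only if \<open>m = 0\<close> and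
  \<open>k = l\<close>.\<close>

section \<open>Groups given by generators and relations\<close>

lemma equiv_free_equiv: "equiv UNIV free_equiv"
  unfolding equiv_def refl_on_def sym_def trans_def free_equiv_def
  by (auto intro: equivclp_sym equivclp_trans)

lemma word_class_eq_iff: "word_class u = word_class v \<longleftrightarrow> equivclp cancels u v"
  using eq_equiv_class_iff[OF equiv_free_equiv, of u v]
  by (simp add: word_class_def free_equiv_def)

lemma cancels_append_right: "cancels u v \<Longrightarrow> cancels (u @ w) (v @ w)"
proof (induction rule: cancels.induct)
  case (1 u x v)
  show ?case
    using cancels.intros(1)[of "u" x "v @ w"] by simp
next
  case (2 u x v)
  show ?case
    using cancels.intros(2)[of "u" x "v @ w"] by simp
qed

lemma cancels_append_left: "cancels u v \<Longrightarrow> cancels (w @ u) (w @ v)"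
proof (induction rule: cancels.induct)
  case (1 u x v)
  show ?case
    using cancels.intros(1)[of "w @ u" x "v"] by simp
next
  case (2 u x v)
  show ?case
    using cancels.intros(2)[of "w @ u" x "v"] by simp
qed

lemma equivclp_cancels_append:
  assumes "equivclp cancels u u'" and "equivclp cancels v v'"
  shows "equivclp cancels (u @ v) (u' @ v')"
proof -
  have "equivclp cancels (u @ v) (u' @ v)"
    using assms(1)
    by (induction rule: equivclp_induct)
       (auto intro: equivclp_into_equivclp cancels_append_right)
  also have "equivclp cancels (u' @ v) (u' @ v')"
    using assms(2)
    by (induction rule: equivclp_induct)
       (auto intro: equivclp_into_equivclp cancels_append_left)
  finally show ?thesis .
qed

lemma carrier_free_group: "carrier free_group = range word_class"
  by (auto simp: free_group_def word_class_def quotient_def)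

lemma one_free_group: "\<one>\<^bsub>free_group\<^esub> = word_class []"
  by (simp add: free_group_def)

lemma word_class_mult: "word_class u \<otimes>\<^bsub>free_group\<^esub> word_class v = word_class (u @ v)"
proof -
  have const: "word_class (u' @ v') = word_class (u @ v)"
    if "u' \<in> word_class u" "v' \<in> word_class v" for u' v'
  proof -
    have "equivclp cancels u' u" "equivclp cancels v' v"
      using that by (auto simp: word_class_def free_equiv_def intro: equivclp_sym)
    then show ?thesis
      unfolding word_class_eq_iff by (rule equivclp_cancels_append)
  qed
  have "u \<in> word_class u" "v \<in> word_class v"
    by (simp_all add: word_class_def free_equiv_def)
  then have "(\<Union>u'\<in>word_class u. \<Union>v'\<in>word_class v. word_class (u' @ v')) = word_class (u @ v)"
    using const by blast
  then show ?thesis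
    by (simp add: free_group_def)
qed

fun flip_letter :: "'g letter \<Rightarrow> 'g letter" where
  "flip_letter (Gen x) = Inv x"
| "flip_letter (Inv x) = Gen x"

lemma word_class_flip_letter: "word_class (flip_letter l # l # w) = word_class w"
  using cancels.intros[of "[]" _ w]
  by (cases l) (auto simp: word_class_eq_iff)

lemma word_class_inverse: "word_class (rev (map flip_letter w) @ w) = word_class []"
proof (induction w)
  case (Cons l w)
  have "word_class (rev (map flip_letter (l # w)) @ l # w)
      = word_class (rev (map flip_letter w)) \<otimes>\<^bsub>free_group\<^esub> word_class (flip_letter l # l # w)"
    by (simp add: word_class_mult)
  also have "\<dots> = word_class []"
    by (simp add: word_class_flip_letter word_class_mult Cons.IH)
  finally show ?case .
qed simp

lemma free_group_cases:
  assumes "X \<in> carrier free_group"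
  obtains w where "X = word_class w"
  using assms unfolding carrier_free_group by blast

lemma word_class_closed: "word_class w \<in> carrier free_group"
  unfolding carrier_free_group by blast

lemma group_free_group: "group (free_group :: 'g letter list set monoid)"
proof (rule groupI)
  fix X Y Z :: "'g letter list set"
  assume X: "X \<in> carrier free_group" and Y: "Y \<in> carrier free_group"
  show "X \<otimes>\<^bsub>free_group\<^esub> Y \<in> carrier free_group"
    using X Y by (elim free_group_cases) (simp add: word_class_mult word_class_closed)
  assume Z: "Z \<in> carrier free_group"
  show "X \<otimes>\<^bsub>free_group\<^esub> Y \<otimes>\<^bsub>free_group\<^esub> Z = X \<otimes>\<^bsub>free_group\<^esub> (Y \<otimes>\<^bsub>free_group\<^esub> Z)"
    using X Y Z by (elim free_group_cases) (simp add: word_class_mult)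
next
  fix X :: "'g letter list set"
  assume X: "X \<in> carrier free_group"
  then show "\<one>\<^bsub>free_group\<^esub> \<otimes>\<^bsub>free_group\<^esub> X = X"
    by (elim free_group_cases) (simp add: one_free_group word_class_mult)
  obtain w where "X = word_class w"
    using X by (rule free_group_cases)
  then have "word_class (rev (map flip_letter w)) \<otimes>\<^bsub>free_group\<^esub> X = \<one>\<^bsub>free_group\<^esub>"
    by (simp add: word_class_mult word_class_inverse one_free_group)
  then show "\<exists>Y\<in>carrier free_group. Y \<otimes>\<^bsub>free_group\<^esub> X = \<one>\<^bsub>free_group\<^esub>"
    using word_class_closed by blast
qed (simp add: one_free_group word_class_closed)

fun eval_letter :: "('a, 'b) monoid_scheme \<Rightarrow> ('g \<Rightarrow> 'a) \<Rightarrow> 'g letter \<Rightarrow> 'a" where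
  "eval_letter H f (Gen x) = f x"
| "eval_letter H f (Inv x) = inv\<^bsub>H\<^esub> f x"

definition eval_word :: "('a, 'b) monoid_scheme \<Rightarrow> ('g \<Rightarrow> 'a) \<Rightarrow> 'g letter list \<Rightarrow> 'a" where
  "eval_word H f w = foldr (\<lambda>l y. eval_letter H f l \<otimes>\<^bsub>H\<^esub> y) w \<one>\<^bsub>H\<^esub>"

context group
begin

lemma mult_inv_cancel [simp]:
  assumes "x \<in> carrier G" and "y \<in> carrier G"
  shows "x \<otimes> (inv x \<otimes> y) = y" and "inv x \<otimes> (x \<otimes> y) = y"
  using assms by (simp_all flip: m_assoc)

lemma eval_word_Nil [simp]: "eval_word G f [] = \<one>"
  by (simp add: eval_word_def)

lemma eval_word_Cons [simp]: "eval_word G f (l # w) = eval_letter G f l \<otimes> eval_word G f w"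
  by (simp add: eval_word_def)

lemma eval_letter_closed: "range f \<subseteq> carrier G \<Longrightarrow> eval_letter G f l \<in> carrier G"
  by (cases l) auto

lemma eval_word_closed: "range f \<subseteq> carrier G \<Longrightarrow> eval_word G f w \<in> carrier G"
  by (induction w) (auto simp: eval_letter_closed)

lemma eval_word_append:
  assumes "range f \<subseteq> carrier G"
  shows "eval_word G f (u @ v) = eval_word G f u \<otimes> eval_word G f v"
  using assms by (induction u) (auto simp: eval_letter_closed eval_word_closed m_assoc)

lemma eval_word_cong_cancels:
  assumes "range f \<subseteq> carrier G" and "equivclp cancels u v"
  shows "eval_word G f u = eval_word G f v"
proof -
  have f: "f x \<in> carrier G" for x
    using assms(1) by auto
  have "eval_word G f u = eval_word G f v" if "cancels u v" for u v
    using that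
    by (induction rule: cancels.induct)
       (simp_all add: eval_word_append eval_word_closed assms(1) f)
  with assms(2) show ?thesis
    by (induction rule: equivclp_induct) auto
qed

text \<open>The universal property of the free group.\<close>

lemma free_group_hom:
  assumes f: "range f \<subseteq> carrier G"
  obtains h where "h \<in> hom free_group G" and "\<And>w. h (word_class w) = eval_word G f w"
proof -
  have "\<exists>h. \<forall>w. eval_word G f w = h (word_class w)"
    using function_factors_left_gen[of "\<lambda>_. True" word_class "eval_word G f"]
      eval_word_cong_cancels[OF f]
    by (auto simp: word_class_eq_iff)
  then obtain h where h: "\<And>w. h (word_class w) = eval_word G f w"
    by metis
  then have "h \<in> hom free_group G"
    by (auto simp: hom_def carrier_free_group word_class_mult eval_word_append eval_word_closed f)
  with h show thesis
    using that by blast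
qed

lemma normal_Inter:
  assumes "\<A> \<noteq> {}" and "\<And>N. N \<in> \<A> \<Longrightarrow> N \<lhd> G"
  shows "\<Inter>\<A> \<lhd> G"
  using assms subgroups_Inter[of \<A>]
  by (auto simp: normal_inv_iff)

lemma normal_carrier: "carrier G \<lhd> G"
  by (simp add: normal_inv_iff subgroup_self)

lemma normal_closure_normal:
  assumes "R \<subseteq> carrier G"
  shows "normal_closure G R \<lhd> G"
  unfolding normal_closure_def hull_def
  using assms normal_carrier by (intro normal_Inter) auto

lemma normal_closure_minimal: "R \<subseteq> N \<Longrightarrow> N \<lhd> G \<Longrightarrow> normal_closure G R \<subseteq> N"
  unfolding normal_closure_def by (rule hull_minimal)

end

definition relator :: "'g letter list \<times> 'g letter list \<Rightarrow> 'g letter list set" where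
  "relator = (\<lambda>(u, v). word_class u \<otimes>\<^bsub>free_group\<^esub> inv\<^bsub>free_group\<^esub> word_class v)"

definition presented_word ::
    "('g letter list \<times> 'g letter list) set \<Rightarrow> 'g letter list \<Rightarrow> 'g letter list set set" where
  "presented_word R w = normal_closure free_group (relator ` R) #>\<^bsub>free_group\<^esub> word_class w"

lemma relator_closed: "relator p \<in> carrier free_group"
proof -
  interpret F: group free_group by (rule group_free_group)
  show ?thesis
    by (cases p) (simp add: relator_def word_class_closed)
qed

lemma normal_relators: "normal_closure free_group (relator ` R) \<lhd> free_group"
  using group.normal_closure_normal[OF group_free_group] relator_closed by blast

lemma presented_group_eq:
  "presented_group R = free_group Mod normal_closure free_group (relator ` R)"
  by (simp add: presented_group_def relator_def)

lemma group_presented_group: "group (presented_group R)"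
  by (simp add: presented_group_eq normal.factorgroup_is_group normal_relators)

lemma carrier_presented_group: "carrier (presented_group R) = range (presented_word R)"
  by (auto simp: presented_group_eq carrier_FactGroup carrier_free_group presented_word_def)

lemma presented_word_mult:
  "presented_word R u \<otimes>\<^bsub>presented_group R\<^esub> presented_word R v = presented_word R (u @ v)"
  using normal.rcos_sum[OF normal_relators, of "word_class u" "word_class v" R]
  by (simp add: presented_group_eq presented_word_def word_class_mult carrier_free_group)

lemma presented_word_Nil: "presented_word R [] = \<one>\<^bsub>presented_group R\<^esub>"
proof -
  interpret group "presented_group R" by (rule group_presented_group)
  have "presented_word R [] \<in> carrier (presented_group R)"
    by (simp add: carrier_presented_group)
  then show ?thesis
    using presented_word_mult[of R "[]" "[]"] r_cancel_one by simp
qed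

text \<open>The word \<open>u\<close> differs from \<open>v\<close> by the factor \<open>u v\<^sup>-\<^sup>1\<close>, which lies in the normal closure.\<close>

lemma presented_word_relation:
  assumes "(u, v) \<in> R"
  shows "presented_word R u = presented_word R v"
proof -
  interpret F: group free_group by (rule group_free_group)
  let ?N = "normal_closure free_group (relator ` R)"
  have N: "subgroup ?N free_group"
    using normal_relators normal_imp_subgroup by blast
  have "relator (u, v) \<in> ?N"
    using assms unfolding normal_closure_def by (intro hull_inc) auto
  then have "word_class u \<in> ?N #>\<^bsub>free_group\<^esub> word_class v"
    using subgroup.rcos_module_rev[OF N group_free_group, of "word_class v" "word_class u"]
    by (simp add: relator_def carrier_free_group)
  then show ?thesis
    unfolding presented_word_def
    using F.repr_independence[OF _ _ N] by (simp add: carrier_free_group)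
qed

lemma presented_word_Inv:
  "presented_word R [Inv x] = inv\<^bsub>presented_group R\<^esub> presented_word R [Gen x]"
proof -
  interpret group "presented_group R" by (rule group_presented_group)
  have "word_class [Inv x, Gen x] = word_class []"
    using word_class_flip_letter[of "Gen x" "[]"] by simp
  then have "presented_word R [Inv x] \<otimes>\<^bsub>presented_group R\<^esub> presented_word R [Gen x] = \<one>\<^bsub>presented_group R\<^esub>"
    by (simp add: presented_word_mult flip: presented_word_Nil) (simp add: presented_word_def)
  then show ?thesis
    by (intro inv_equality[symmetric]) (auto simp: carrier_presented_group)
qed

text \<open>A word is the product of its letters, and by lemma \<open>presented_word_Inv\<close> each letter is a generator or
  the inverse of one.\<close>

lemma presented_group_generated:
  "generate (presented_group R) (range (\<lambda>x. presented_word R [Gen x])) = carrier (presented_group R)"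
  (is "generate ?G ?S = _")
proof -
  interpret group ?G by (rule group_presented_group)
  have letter: "presented_word R [l] \<in> generate ?G ?S" for l
    by (cases l) (auto simp: presented_word_Inv intro: generate.intros)
  have "presented_word R w \<in> generate ?G ?S" for w
  proof (induction w)
    case Nil
    show ?case
      by (simp add: presented_word_Nil generate.one)
  next
    case (Cons l w)
    then show ?case
      using generate.eng[OF letter[of l] Cons] by (simp add: presented_word_mult)
  qed
  moreover have "generate ?G ?S \<subseteq> carrier ?G"
    by (rule generate_incl) (auto simp: carrier_presented_group)
  ultimately show ?thesis
    by (auto simp: carrier_presented_group)
qed

text \<open>Von Dyck's theorem. The homomorphism from the free group that extends \<open>f\<close> kills every relator;
  its kernel is normal, so it contains the normal closure of the relators.\<close>

lemma presented_group_hom: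
  assumes "group H" and f: "range f \<subseteq> carrier H"
    and rel: "\<And>u v. (u, v) \<in> R \<Longrightarrow> eval_word H f u = eval_word H f v"
  obtains h where "h \<in> hom (presented_group R) H" and "\<And>x. h (presented_word R [Gen x]) = f x"
proof -
  interpret H: group H by fact
  interpret F: group free_group by (rule group_free_group)
  obtain h where h: "h \<in> hom free_group H" "\<And>w. h (word_class w) = eval_word H f w"
    using H.free_group_hom[OF f] by blast
  interpret h: group_hom free_group H h
    using h(1) by unfold_locales
  have "relator p \<in> kernel free_group H h" if "p \<in> R" for p
  proof (cases p)
    case (Pair u v)
    have "h (relator p) = eval_word H f u \<otimes>\<^bsub>H\<^esub> inv\<^bsub>H\<^esub> eval_word H f v"
      by (simp add: Pair relator_def word_class_closed flip: h(2))
    then show ?thesis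
      using that rel[of u v] Pair relator_closed[of p] H.eval_word_closed[OF f]
      by (simp add: kernel_def)
  qed
  then have "normal_closure free_group (relator ` R) \<subseteq> kernel free_group H h"
    by (intro F.normal_closure_minimal h.normal_kernel) auto
  then obtain g where "g \<in> hom (presented_group R) H"
    "\<And>X. X \<in> carrier free_group \<Longrightarrow>
      g (normal_closure free_group (relator ` R) #>\<^bsub>free_group\<^esub> X) = h X"
    using h.FactGroup_universal_kernel[OF normal_relators] unfolding presented_group_eq by metis
  with that show thesis
    using f by (auto simp: presented_word_def carrier_free_group h image_subset_iff)
qed

section \<open>Left-orderings and positive cones\<close>

text \<open>A left-ordering is determined by its positive cone, since \<open>x \<prec> y\<close> if and only if
  \<open>x\<^sup>-\<^sup>1 y\<close> is positive. The conditions of the locale \<open>group_cone\<close> below are the ones that characterize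
  the sets that arise in this way.\<close>

definition cone_order :: "('a, 'b) monoid_scheme \<Rightarrow> 'a set \<Rightarrow> 'a rel" where
  "cone_order G P =
    {(x, y). x \<in> carrier G \<and> y \<in> carrier G \<and> (x = y \<or> inv\<^bsub>G\<^esub> x \<otimes>\<^bsub>G\<^esub> y \<in> P)}"

locale group_cone = group +
  fixes P
  assumes cone_subset: "P \<subseteq> carrier G"
    and one_notin_cone: "\<one> \<notin> P"
    and cone_mult: "x \<in> P \<Longrightarrow> y \<in> P \<Longrightarrow> x \<otimes> y \<in> P"
    and cone_total: "x \<in> carrier G \<Longrightarrow> x \<noteq> \<one> \<Longrightarrow> x \<in> P \<or> inv x \<in> P"
begin

lemma left_ordering_cone_order: "left_ordering G (cone_order G P)"
proof -
  have trans: "inv x \<otimes> z \<in> P"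
    if "inv x \<otimes> y \<in> P" "inv y \<otimes> z \<in> P"
      and [simp]: "x \<in> carrier G" "y \<in> carrier G" "z \<in> carrier G" for x y z
  proof -
    have "(inv x \<otimes> y) \<otimes> (inv y \<otimes> z) = inv x \<otimes> z"
      by (simp add: m_assoc)
    then show ?thesis
      using cone_mult[OF that(1,2)] by simp
  qed
  have irrefl: "inv x \<otimes> x \<notin> P" if "x \<in> carrier G" for x
    using that one_notin_cone by simp
  have total: "inv x \<otimes> y \<in> P \<or> inv y \<otimes> x \<in> P"
    if [simp]: "x \<in> carrier G" "y \<in> carrier G" and "x \<noteq> y" for x y
  proof -
    have "inv x \<otimes> y \<noteq> \<one>"
    proof
      assume "inv x \<otimes> y = \<one>"
      then have "x \<otimes> (inv x \<otimes> y) = x"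
        by simp
      with \<open>x \<noteq> y\<close> show False
        by simp
    qed
    then have "inv x \<otimes> y \<in> P \<or> inv (inv x \<otimes> y) \<in> P"
      by (intro cone_total) simp_all
    moreover have "inv (inv x \<otimes> y) = inv y \<otimes> x"
      by (simp add: inv_mult_group)
    ultimately show ?thesis
      by metis
  qed
  have shift: "inv (z \<otimes> x) \<otimes> (z \<otimes> y) = inv x \<otimes> y"
    if [simp]: "x \<in> carrier G" "y \<in> carrier G" "z \<in> carrier G" for x y z
    by (simp add: inv_mult_group m_assoc)
  have "antisym (cone_order G P)"
  proof (rule antisymI)
    fix x y
    assume xy: "(x, y) \<in> cone_order G P" "(y, x) \<in> cone_order G P"
    then have "x \<in> carrier G" "y \<in> carrier G"
      by (auto simp: cone_order_def)
    then show "x = y"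
      using xy trans[of x y x] irrefl[of x] unfolding cone_order_def by blast
  qed
  moreover have "trans (cone_order G P)"
  proof (rule transI)
    fix x y z
    assume "(x, y) \<in> cone_order G P" "(y, z) \<in> cone_order G P"
    then show "(x, z) \<in> cone_order G P"
      using trans[of x y z] unfolding cone_order_def by blast
  qed
  moreover have "refl_on (carrier G) (cone_order G P)" "cone_order G P \<subseteq> carrier G \<times> carrier G"
    by (auto simp: refl_on_def cone_order_def)
  moreover have "total_on (carrier G) (cone_order G P)"
    unfolding total_on_def cone_order_def using total by blast
  ultimately have "linear_order_on (carrier G) (cone_order G P)"
    unfolding order_on_defs by blast
  moreover have "(z \<otimes> x, z \<otimes> y) \<in> cone_order G P - Id"
    if "x \<in> carrier G" "y \<in> carrier G" "z \<in> carrier G" "(x, y) \<in> cone_order G P - Id" for x y z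
    using that shift[of x y z] by (auto simp: cone_order_def)
  ultimately show ?thesis
    unfolding left_ordering_def by blast
qed

lemma positive_cone_cone_order: "positive_cone G (cone_order G P) = P"
  using cone_subset one_notin_cone by (auto simp: positive_cone_def cone_order_def)

end

context group
begin

lemma left_ordering_group_cone:
  assumes r: "left_ordering G r"
  shows "group_cone G (positive_cone G r)"
proof -
  have lin: "linear_order_on (carrier G) r"
    and left: "\<And>x y z. x \<in> carrier G \<Longrightarrow> y \<in> carrier G \<Longrightarrow> z \<in> carrier G \<Longrightarrow>
      (x, y) \<in> r - Id \<Longrightarrow> (z \<otimes> x, z \<otimes> y) \<in> r - Id"
    using r unfolding left_ordering_def by blast+
  show ?thesis
  proof unfold_locales
    fix x y
    assume *: "x \<in> positive_cone G r" "y \<in> positive_cone G r"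
    then have carr: "x \<in> carrier G" "y \<in> carrier G"
      and x: "(\<one>, x) \<in> r - Id" and y: "(\<one>, y) \<in> r - Id"
      by (auto simp: positive_cone_def)
    have "(x, x \<otimes> y) \<in> r - Id"
      using left[OF _ _ _ y, of x] carr by simp
    moreover have "trans (r - Id)"
      using lin by (auto simp: order_on_defs intro: trans_diff_Id)
    ultimately have "(\<one>, x \<otimes> y) \<in> r - Id"
      using x by (metis transD)
    then show "x \<otimes> y \<in> positive_cone G r"
      using carr by (simp add: positive_cone_def)
  next
    fix x
    assume x: "x \<in> carrier G" "x \<noteq> \<one>"
    then have "(\<one>, x) \<in> r \<or> (x, \<one>) \<in> r"
      using lin unfolding order_on_defs total_on_def by (metis one_closed)
    then show "x \<in> positive_cone G r \<or> inv x \<in> positive_cone G r"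
      using x left[of x \<one> "inv x"] by (auto simp: positive_cone_def)
  qed (auto simp: positive_cone_def)
qed

lemma left_ordering_eq_cone_order:
  assumes r: "left_ordering G r"
  shows "cone_order G (positive_cone G r) = r"
proof -
  have lin: "linear_order_on (carrier G) r"
    and left: "\<And>x y z. x \<in> carrier G \<Longrightarrow> y \<in> carrier G \<Longrightarrow> z \<in> carrier G \<Longrightarrow>
      (x, y) \<in> r - Id \<Longrightarrow> (z \<otimes> x, z \<otimes> y) \<in> r - Id"
    using r unfolding left_ordering_def by blast+
  have dom: "r \<subseteq> carrier G \<times> carrier G" and refl: "refl_on (carrier G) r"
    using lin by (auto simp: order_on_defs)
  have "(x, y) \<in> r - Id \<longleftrightarrow> (\<one>, inv x \<otimes> y) \<in> r - Id"
    if [simp]: "x \<in> carrier G" "y \<in> carrier G" for x y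
  proof
    assume "(x, y) \<in> r - Id"
    from left[OF _ _ _ this, of "inv x"] show "(\<one>, inv x \<otimes> y) \<in> r - Id"
      by simp
  next
    assume "(\<one>, inv x \<otimes> y) \<in> r - Id"
    from left[OF _ _ _ this, of x] show "(x, y) \<in> r - Id"
      by (simp flip: m_assoc)
  qed
  then show ?thesis
    using dom refl by (auto simp: cone_order_def positive_cone_def refl_on_def)
qed

text \<open>An element \<open>q\<close> of \<open>Q\<close> outside \<open>P\<close> would have its inverse in \<open>P\<close>, so both \<open>q\<close> and \<open>q\<^sup>-\<^sup>1\<close> would be in
  \<open>Q\<close>, and hence also their product.\<close>

lemma group_cone_eqI:
  assumes "group_cone G P" and "group_cone G Q" and "P \<subseteq> Q"
  shows "P = Q"
proof -
  interpret P: group_cone G P by fact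
  interpret Q: group_cone G Q by fact
  have "q \<in> P" if "q \<in> Q" for q
  proof (rule ccontr)
    assume "q \<notin> P"
    moreover have "q \<in> carrier G" "q \<noteq> \<one>"
      using that Q.cone_subset Q.one_notin_cone by auto
    ultimately have "inv q \<in> Q"
      using P.cone_total \<open>P \<subseteq> Q\<close> by blast
    with that have "q \<otimes> inv q \<in> Q"
      by (rule Q.cone_mult)
    then show False
      using \<open>q \<in> carrier G\<close> Q.one_notin_cone by simp
  qed
  with \<open>P \<subseteq> Q\<close> show ?thesis by blast
qed

text \<open>The criterion for isolation used below: it suffices that \<open>P\<close> is the least cone that contains \<open>F\<close>,
  because cones are incomparable.\<close>

lemma isolated_cone_order:
  assumes P: "group_cone G P" and "finite F" and "F \<subseteq> P"
    and least: "\<And>Q. group_cone G Q \<Longrightarrow> F \<subseteq> Q \<Longrightarrow> P \<subseteq> Q"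
  shows "isolated_left_ordering G (cone_order G P)"
proof -
  interpret P: group_cone G P by fact
  have "r = cone_order G P" if "left_ordering G r" "F \<subseteq> positive_cone G r" for r
    using that left_ordering_group_cone left_ordering_eq_cone_order least group_cone_eqI[OF P]
    by metis
  moreover have "F \<subseteq> carrier G"
    using \<open>F \<subseteq> P\<close> P.cone_subset by blast
  ultimately show ?thesis
    unfolding isolated_left_ordering_def
    using P.left_ordering_cone_order P.positive_cone_cone_order \<open>finite F\<close> \<open>F \<subseteq> P\<close> by metis
qed

end

section \<open>The group of affine maps with slope a power of -2\<close>

text \<open>The pair \<open>(x, n)\<close> is the map \<open>t \<mapsto> x + (-2)\<^sup>n t\<close>, and multiplication is composition. The
  presented group embeds here as the subgroup of the pairs with dyadic \<open>x\<close>; admitting every rational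
  \<open>x\<close> makes the whole type the carrier.\<close>

definition affine_group :: "(rat \<times> int) monoid" where
  "affine_group =
    \<lparr>carrier = UNIV,
     mult = (\<lambda>(x, n) (y, m). (x + (-2) powi n * y, n + m)),
     one = (0, 0)\<rparr>"

lemma affine_group_simps [simp]:
  "carrier affine_group = UNIV"
  "p \<otimes>\<^bsub>affine_group\<^esub> q = (fst p + (-2) powi snd p * fst q, snd p + snd q)"
  "\<one>\<^bsub>affine_group\<^esub> = (0, 0)"
  by (simp_all add: affine_group_def case_prod_beta)

lemma group_affine_group: "group affine_group"
proof (rule groupI)
  fix p :: "rat \<times> int"
  show "\<exists>q\<in>carrier affine_group. q \<otimes>\<^bsub>affine_group\<^esub> p = \<one>\<^bsub>affine_group\<^esub>"
    by (intro bexI[of _ "(- ((-2) powi (- snd p) * fst p), - snd p)"]) simp_all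
qed (simp_all add: power_int_add algebra_simps)

lemma affine_group_inv [simp]:
  "inv\<^bsub>affine_group\<^esub> p = (- ((-2) powi (- snd p) * fst p), - snd p)"
  by (rule group.inv_equality[OF group_affine_group]) simp_all

text \<open>The properties of the presented group that are needed below: it is generated by \<open>a\<close> and \<open>b\<close>
  subject to the relation, and it maps to \<open>affine_group\<close>. The relation gives the normal form, and the
  homomorphism then shows that the normal form does not collapse any further.\<close>

locale marked_affine_group = group +
  fixes a b \<phi>
  assumes a_closed [simp]: "a \<in> carrier G" and b_closed [simp]: "b \<in> carrier G"
    and relation: "b \<otimes> a \<otimes> inv b = inv a \<otimes> inv a"
    and generated: "generate G {a, b} = carrier G"
    and hom_affine: "\<phi> \<in> hom G affine_group"
    and \<phi>_a [simp]: "\<phi> a = (1, 0)" and \<phi>_b [simp]: "\<phi> b = (0, 1)"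

sublocale marked_affine_group \<subseteq> \<phi>: group_hom G affine_group \<phi>
  by (simp add: group_hom_def group_hom_axioms_def group_affine_group hom_affine)

context marked_affine_group
begin

lemma \<phi>_b_pow: "\<phi> (b [^] (k::nat)) = (0, int k)"
  by (induction k) simp_all

lemma \<phi>_translation_pow:
  assumes "x \<in> carrier G" and "snd (\<phi> x) = 0"
  shows "\<phi> (x [^] (k::nat)) = (of_nat k * fst (\<phi> x), 0)"
  using assms by (induction k) (simp_all add: algebra_simps)

lemma \<phi>_a_pow: "\<phi> (a [^] (m::int)) = (of_int m, 0)"
proof (cases m rule: int_cases2)
  case (nonneg n)
  then show ?thesis
    using \<phi>_translation_pow[of a n] by (simp only: int_pow_int) simp
next
  case (nonpos n)
  then show ?thesis
    using \<phi>_translation_pow[of a n] by (simp only: int_pow_neg_int a_closed) simp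
qed

lemma b_conj_a_pow: "b \<otimes> a [^] (m::int) \<otimes> inv b = a [^] (-2 * m)"
proof -
  have "(\<lambda>x. b \<otimes> x \<otimes> inv b) \<in> hom G G"
    by (rule homI) (simp_all add: m_assoc)
  then have "b \<otimes> a [^] m \<otimes> inv b = (b \<otimes> a \<otimes> inv b) [^] m"
    using hom_int_pow[of "\<lambda>x. b \<otimes> x \<otimes> inv b" G G a m] is_group by simp
  also have "b \<otimes> a \<otimes> inv b = a [^] (-2::int)"
    using int_pow_neg[OF a_closed, of 2] int_pow_mult[OF a_closed, of 1 1]
    by (simp add: relation inv_mult_group)
  finally show ?thesis
    by (simp add: int_pow_pow)
qed

lemma b_mult_a_pow: "b \<otimes> a [^] (m::int) = a [^] (-2 * m) \<otimes> b"
proof -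
  have "b \<otimes> a [^] m = b \<otimes> a [^] m \<otimes> inv b \<otimes> b"
    by (simp add: m_assoc)
  then show ?thesis
    by (simp only: b_conj_a_pow)
qed

lemma b_pow_mult_a_pow: "b [^] (k::nat) \<otimes> a [^] (m::int) = a [^] ((-2) ^ k * m) \<otimes> b [^] k"
proof (induction k arbitrary: m)
  case (Suc k)
  have "b [^] Suc k \<otimes> a [^] m = b [^] k \<otimes> a [^] (-2 * m) \<otimes> b"
    by (simp add: m_assoc b_mult_a_pow)
  also have "\<dots> = a [^] ((-2) ^ Suc k * m) \<otimes> b [^] Suc k"
    by (simp only: Suc) (simp add: m_assoc mult.assoc mult.left_commute)
  finally show ?case .
qed simp

definition normal_form :: "nat \<Rightarrow> int \<Rightarrow> nat \<Rightarrow> 'a" where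
  "normal_form k m l = inv (b [^] k) \<otimes> a [^] m \<otimes> b [^] l"

lemma normal_form_closed [simp]: "normal_form k m l \<in> carrier G"
  by (simp add: normal_form_def)

lemma \<phi>_normal_form: "\<phi> (normal_form k m l) = ((-2) powi (- int k) * of_int m, int l - int k)"
  by (simp add: normal_form_def \<phi>_b_pow \<phi>_a_pow)

lemma a_pow_mult_normal_form:
  "a [^] (j::int) \<otimes> normal_form k m l = normal_form k ((-2) ^ k * j + m) l"
proof -
  have "a [^] j \<otimes> inv (b [^] k) = inv (b [^] k) \<otimes> (b [^] k \<otimes> a [^] j) \<otimes> inv (b [^] k)"
    by (simp add: m_assoc)
  also have "\<dots> = inv (b [^] k) \<otimes> a [^] ((-2) ^ k * j)"
    by (simp add: b_pow_mult_a_pow m_assoc)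
  finally have "a [^] j \<otimes> inv (b [^] k) = inv (b [^] k) \<otimes> a [^] ((-2) ^ k * j)" .
  then have "a [^] j \<otimes> inv (b [^] k) \<otimes> (a [^] m \<otimes> b [^] l)
      = inv (b [^] k) \<otimes> (a [^] ((-2) ^ k * j) \<otimes> a [^] m) \<otimes> b [^] l"
    by (simp add: m_assoc)
  then show ?thesis
    by (simp add: normal_form_def m_assoc int_pow_mult)
qed

lemma inv_b_mult_normal_form: "inv b \<otimes> normal_form k m l = normal_form (Suc k) m l"
  by (simp add: normal_form_def inv_mult_group m_assoc)

lemma b_mult_normal_form: "\<exists>k' m' l'. b \<otimes> normal_form k m l = normal_form k' m' l'"
proof (cases k)
  case 0
  have "b \<otimes> normal_form 0 m l = (b \<otimes> a [^] m) \<otimes> b [^] l"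
    by (simp add: normal_form_def m_assoc)
  also have "\<dots> = normal_form 0 (-2 * m) (Suc l)"
    using nat_pow_Suc2[OF b_closed, of l]
    by (simp only: b_mult_a_pow) (simp add: normal_form_def m_assoc)
  finally show ?thesis
    using 0 by blast
next
  case (Suc k')
  have "b \<otimes> normal_form k m l = b \<otimes> (inv b \<otimes> normal_form k' m l)"
    by (simp add: Suc inv_b_mult_normal_form)
  then show ?thesis
    by auto
qed

text \<open>The set of normal forms is closed under left multiplication by \<open>a\<close>, \<open>b\<close> and their inverses, hence by
  all elements. The induction is on the left factor, so that a product of two factors needs only
  associativity and never the product of two normal forms.\<close>

lemma normal_form_exists:
  assumes "g \<in> carrier G"
  obtains k m l where "g = normal_form k m l"
proof -
  have "\<forall>k m l. \<exists>k' m' l'. g \<otimes> normal_form k m l = normal_form k' m' l'"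
    if "g \<in> generate G {a, b}" for g
    using that
  proof (induction rule: generate.induct)
    case one
    then show ?case by auto
  next
    case (incl h)
    moreover have "\<exists>k' m' l'. a \<otimes> normal_form k m l = normal_form k' m' l'" for k m l
      using a_pow_mult_normal_form[of 1 k m l] by (metis a_closed int_pow_1)
    ultimately show ?case
      using b_mult_normal_form by blast
  next
    case (inv h)
    moreover have "\<exists>k' m' l'. inv a \<otimes> normal_form k m l = normal_form k' m' l'" for k m l
      using a_pow_mult_normal_form[of "-1" k m l] by (metis a_closed int_pow_1 int_pow_neg)
    ultimately show ?case
      using inv_b_mult_normal_form by blast
  next
    case (eng h1 h2)
    then have "h1 \<in> carrier G" "h2 \<in> carrier G"
      using generated by auto
    with eng.IH show ?case
      by (metis m_assoc normal_form_closed)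
  qed
  moreover have "g = g \<otimes> normal_form 0 0 0"
    using assms by (simp add: normal_form_def)
  ultimately show thesis
    using assms that generated by metis
qed

lemma \<phi>_inj:
  assumes "g \<in> carrier G" and "h \<in> carrier G" and "\<phi> g = \<phi> h"
  shows "g = h"
proof -
  have "x = \<one>" if x: "x \<in> carrier G" "\<phi> x = (0, 0)" for x
  proof -
    obtain k m l where "x = normal_form k m l"
      using x(1) by (rule normal_form_exists)
    with x(2) show ?thesis
      by (simp add: \<phi>_normal_form) (simp add: normal_form_def)
  qed
  then have "inj_on \<phi> (carrier G)"
    by (simp add: \<phi>.inj_on_one_iff)
  with assms show ?thesis
    by (simp add: inj_on_def)
qed

text \<open>The exponent \<open>k\<close> of the normal form works: \<open>x = (-2)\<^sup>-\<^sup>k m\<close>.\<close>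

lemma dyadic_coordinate:
  assumes "g \<in> carrier G"
  shows "\<exists>k::nat. 2 ^ k * fst (\<phi> g) \<in> \<int>"
proof -
  obtain k m l where g: "g = normal_form k m l"
    using assms by (rule normal_form_exists)
  have "2 ^ k * fst (\<phi> g) = (-1) ^ k * ((-2) ^ k * fst (\<phi> g))"
    by (simp flip: power_mult_distrib mult.assoc)
  also have "\<dots> = of_int ((-1) ^ k * m)"
    by (simp add: g \<phi>_normal_form power_int_minus)
  finally show ?thesis
    by (metis Ints_of_int)
qed

definition cone :: "'a set" where
  "cone = {g \<in> carrier G. 0 < snd (\<phi> g) \<or> snd (\<phi> g) = 0 \<and> 0 < fst (\<phi> g)}"

lemma group_cone_cone: "group_cone G cone"
proof unfold_locales
  fix x y
  assume "x \<in> cone" "y \<in> cone"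
  then show "x \<otimes> y \<in> cone"
    by (auto simp: cone_def)
next
  fix x
  assume x: "x \<in> carrier G" "x \<noteq> \<one>"
  then have "\<phi> x \<noteq> (0, 0)"
    using \<phi>_inj[of x \<one>] by auto
  then show "x \<in> cone \<or> inv x \<in> cone"
    using x(1) by (cases "\<phi> x") (auto simp: cone_def)
qed (auto simp: cone_def)

text \<open>Induction on the exponent \<open>k\<close> of the denominator \<open>2\<^sup>k\<close> of \<open>x\<close>: the square of \<open>(x, 0)\<close> is \<open>(2x, 0)\<close>,
  and an element whose square is positive is positive. If \<open>x\<close> is an integer, then \<open>(x, 0)\<close> is a power
  of \<open>a\<close>.\<close>

lemma translation_in_cone:
  assumes "group_cone G Q" and "a \<in> Q" and "g \<in> carrier G"
    and "snd (\<phi> g) = 0" and "0 < fst (\<phi> g)"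
  shows "g \<in> Q"
proof -
  interpret Q: group_cone G Q by fact
  have pow: "a [^] Suc n \<in> Q" for n
    using \<open>a \<in> Q\<close> by (induction n) (auto intro: Q.cone_mult)
  have root: "h \<in> Q" if "h \<in> carrier G" "h \<otimes> h \<in> Q" for h
  proof (rule ccontr)
    assume "h \<notin> Q"
    moreover have "h \<noteq> \<one>"
      using that Q.one_notin_cone by auto
    ultimately have "inv h \<in> Q"
      using that(1) Q.cone_total by blast
    with that(2) have "inv h \<otimes> (inv h \<otimes> (h \<otimes> h)) \<in> Q"
      by (blast intro: Q.cone_mult)
    then show False
      using that(1) Q.one_notin_cone by simp
  qed
  have "g \<in> Q"
    if "2 ^ k * fst (\<phi> g) \<in> \<int>" "g \<in> carrier G" "snd (\<phi> g) = 0" "0 < fst (\<phi> g)" for k g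
    using that
  proof (induction k arbitrary: g)
    case 0
    then obtain m :: int where m: "fst (\<phi> g) = of_int m"
      by (metis Ints_cases mult_1 power_0)
    then obtain n where n: "m = int (Suc n)"
      using 0 by (metis of_int_0_less_iff gr0_implies_Suc zero_less_imp_eq_int)
    have "\<phi> (a [^] Suc n) = (of_nat (Suc n) * 1, 0)"
      using \<phi>_translation_pow[of a "Suc n"] by (simp only: a_closed \<phi>_a fst_conv snd_conv)
    also have "\<dots> = \<phi> g"
      using 0 m n by (simp add: prod_eq_iff)
    finally have "a [^] Suc n = g"
      using 0 by (intro \<phi>_inj) auto
    with pow show ?case
      by metis
  next
    case (Suc k)
    then have "\<phi> (g \<otimes> g) = (2 * fst (\<phi> g), 0)"
      by simp
    then have "g \<otimes> g \<in> Q"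
      using Suc by (intro Suc.IH) (auto simp: algebra_simps)
    then show ?case
      using root Suc by blast
  qed
  with dyadic_coordinate assms show ?thesis
    by blast
qed

text \<open>Each element of the cone with \<open>n > 0\<close> is a power of \<open>b\<close> or a product of a positive translation and
  powers of \<open>b\<close>. If \<open>x < 0\<close>, then moving the translation past one \<open>b\<close> makes it positive, because \<open>b\<close> acts by a negative
  factor.\<close>

lemma cone_least:
  assumes "group_cone G Q" and "a \<in> Q" and "b \<in> Q"
  shows "cone \<subseteq> Q"
proof
  interpret Q: group_cone G Q by fact
  have pow: "b [^] Suc n \<in> Q" for n
    using \<open>b \<in> Q\<close> by (induction n) (auto intro: Q.cone_mult)
  fix g
  assume g: "g \<in> cone"
  then have carr [simp]: "g \<in> carrier G"
    by (simp add: cone_def)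
  show "g \<in> Q"
  proof (cases "snd (\<phi> g) = 0")
    case True
    with g assms show ?thesis
      by (auto simp: cone_def intro: translation_in_cone)
  next
    case False
    with g have "0 < snd (\<phi> g)"
      by (simp add: cone_def)
    then obtain n where n: "snd (\<phi> g) = int (Suc n)"
      by (metis gr0_implies_Suc zero_less_imp_eq_int)
    consider "fst (\<phi> g) = 0" | "fst (\<phi> g) > 0" | "fst (\<phi> g) < 0"
      by linarith
    then show ?thesis
    proof cases
      case 1
      then have "g = b [^] Suc n"
        using n \<phi>_b_pow[of "Suc n"] by (intro \<phi>_inj) (auto simp: prod_eq_iff)
      then show ?thesis
        using pow by simp
    next
      case 2
      let ?h = "g \<otimes> inv (b [^] Suc n)"
      have "\<phi> ?h = (fst (\<phi> g), 0)"
        using n by (simp add: \<phi>_b_pow del: nat_pow_Suc)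
      then have "snd (\<phi> ?h) = 0" "0 < fst (\<phi> ?h)"
        using 2 by (simp_all only: fst_conv snd_conv)
      then have "?h \<in> Q"
        by (intro translation_in_cone[OF assms(1,2)]) simp_all
      then have "?h \<otimes> b [^] Suc n \<in> Q"
        using pow by (rule Q.cone_mult)
      then show ?thesis
        by (simp add: m_assoc del: nat_pow_Suc)
    next
      case 3
      let ?h = "inv b \<otimes> g \<otimes> inv (b [^] n)"
      have "\<phi> ?h = (- fst (\<phi> g) / 2, 0)"
        using n by (simp add: \<phi>_b_pow power_int_minus)
      then have "snd (\<phi> ?h) = 0" "0 < fst (\<phi> ?h)"
        using 3 by (simp_all only: fst_conv snd_conv)
      then have "?h \<in> Q"
        by (intro translation_in_cone[OF assms(1,2)]) simp_all
      then have h: "b \<otimes> ?h \<in> Q"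
        using Q.cone_mult[OF \<open>b \<in> Q\<close>] by blast
      have eq: "g = b \<otimes> ?h \<otimes> b [^] n"
        by (simp add: m_assoc)
      show ?thesis
      proof (cases n)
        case 0
        with h eq show ?thesis by simp
      next
        case (Suc n')
        then have "b \<otimes> ?h \<otimes> b [^] n \<in> Q"
          using h pow by (metis Q.cone_mult)
        with eq show ?thesis by simp
      qed
    qed
  qed
qed

lemma isolated_cone: "isolated_left_ordering G (cone_order G cone)"
  using group_cone_cone cone_least
  by (intro isolated_cone_order[of _ "{a, b}"]) (auto simp: cone_def)

text \<open>If \<open>2\<^sup>K\<close> is a common denominator of the generators, then the elements of the cone that either have
  \<open>n > 0\<close> or have denominator dividing \<open>2\<^sup>K\<close> form a semigroup that contains all generators. It is a
  proper subset of the cone.\<close>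

lemma cone_not_finitely_generated: "\<not> finitely_generated_semigroup G cone"
proof
  interpret cone: group_cone G cone by (rule group_cone_cone)
  assume "finitely_generated_semigroup G cone"
  then obtain S where S: "finite S" "S \<subseteq> cone" "semigroup_generated G S = cone"
    unfolding finitely_generated_semigroup_def by blast
  have "\<exists>K::nat. \<forall>s\<in>S. 2 ^ K * fst (\<phi> s) \<in> \<int>"
  proof -
    have "\<forall>s\<in>S. \<exists>k::nat. 2 ^ k * fst (\<phi> s) \<in> \<int>"
      using S(2) dyadic_coordinate cone.cone_subset by blast
    then obtain k :: "_ \<Rightarrow> nat" where k: "\<And>s. s \<in> S \<Longrightarrow> 2 ^ k s * fst (\<phi> s) \<in> \<int>"
      by metis
    have "2 ^ Max (k ` S) * fst (\<phi> s) \<in> \<int>" if "s \<in> S" for s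
    proof -
      have "k s \<le> Max (k ` S)"
        using that S(1) by simp
      then have eq: "2 ^ Max (k ` S) * fst (\<phi> s) = 2 ^ (Max (k ` S) - k s) * (2 ^ k s * fst (\<phi> s))"
        by (simp flip: power_add mult.assoc)
      show ?thesis
        unfolding eq by (rule Ints_mult[OF _ k[OF that]]) simp
    qed
    then show ?thesis by blast
  qed
  then obtain K :: nat where K: "\<And>s. s \<in> S \<Longrightarrow> 2 ^ K * fst (\<phi> s) \<in> \<int>"
    by blast
  let ?T = "{g \<in> cone. snd (\<phi> g) = 0 \<longrightarrow> 2 ^ K * fst (\<phi> g) \<in> \<int>}"
  have "x \<otimes> y \<in> ?T" if "x \<in> ?T" "y \<in> ?T" for x y
  proof -
    have xy: "x \<in> carrier G" "y \<in> carrier G" "0 \<le> snd (\<phi> x)" "0 \<le> snd (\<phi> y)"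
      using that by (auto simp: cone_def)
    have "2 ^ K * fst (\<phi> (x \<otimes> y)) \<in> \<int>" if "snd (\<phi> (x \<otimes> y)) = 0"
    proof -
      have "snd (\<phi> x) = 0" "snd (\<phi> y) = 0"
        using that xy by simp_all
      then show ?thesis
        using \<open>x \<in> ?T\<close> \<open>y \<in> ?T\<close> xy by (simp add: distrib_left)
    qed
    then show ?thesis
      using that cone.cone_mult by blast
  qed
  moreover have "S \<subseteq> ?T"
    using S(2) K by auto
  ultimately have "cone \<subseteq> ?T"
    unfolding S(3)[symmetric] semigroup_generated_def by (intro hull_minimal) blast+
  \<comment> \<open>The exponent of \<open>b\<close> is even, so that the translation is positive, and larger than \<open>K\<close>.\<close>
  moreover
  have \<phi>: "\<phi> (normal_form (2 * Suc K) 1 (2 * Suc K)) = (1 / 4 ^ Suc K, 0)"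
    by (simp only: \<phi>_normal_form power_int_minus power_int_of_nat power_mult) (simp add: field_simps)
  then have "normal_form (2 * Suc K) 1 (2 * Suc K) \<in> cone"
    by (simp add: cone_def)
  ultimately have "2 ^ K * (1 / 4 ^ Suc K :: rat) \<in> \<int>"
    using \<phi> by force
  moreover have "2 ^ K * (1 / 4 ^ Suc K :: rat) = 1 / (4 * 2 ^ K)"
    by (simp add: field_simps flip: power_mult_distrib)
  ultimately have "1 / (4 * 2 ^ K) \<in> (\<int> :: rat set)"
    by simp
  then obtain i :: int where i: "1 / (4 * 2 ^ K) = (of_int i :: rat)"
    by (auto elim: Ints_cases)
  have "(1::rat) \<le> 2 ^ K"
    by simp
  then have "(1::rat) < 4 * 2 ^ K"
    by linarith
  then have "(0::rat) < 1 / (4 * 2 ^ K)" "1 / (4 * 2 ^ K) < (1::rat)"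
    by simp_all
  then have "0 < i" "i < 1"
    unfolding i by simp_all
  then show False
    by simp
qed

end

section \<open>The presented group\<close>

lemma Gamma_marked:
  obtains a b \<phi> where "marked_affine_group Gamma a b \<phi>"
proof -
  define R where "R = {([Gen gen_b, Gen gen_a, Inv gen_b], [Inv gen_a, Inv gen_a])}"
  have Gamma: "Gamma = presented_group R"
    by (simp add: Gamma_def R_def)
  interpret group Gamma
    unfolding Gamma by (rule group_presented_group)
  define a where "a = presented_word R [Gen gen_a]"
  define b where "b = presented_word R [Gen gen_b]"
  define f :: "gen \<Rightarrow> rat \<times> int" where "f = case_gen (1, 0) (0, 1)"
  have "eval_word affine_group f u = eval_word affine_group f v" if "(u, v) \<in> R" for u v
    using that by (simp add: R_def f_def eval_word_def affine_group_inv)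
  then obtain \<phi> where \<phi>: "\<phi> \<in> hom Gamma affine_group" "\<And>x. \<phi> (presented_word R [Gen x]) = f x"
    using presented_group_hom[OF group_affine_group, of f R] unfolding Gamma by auto
  have "presented_word R [Gen gen_b, Gen gen_a, Inv gen_b] = presented_word R [Inv gen_a, Inv gen_a]"
    by (rule presented_word_relation) (simp add: R_def)
  then have "b \<otimes>\<^bsub>Gamma\<^esub> a \<otimes>\<^bsub>Gamma\<^esub> inv\<^bsub>Gamma\<^esub> b = inv\<^bsub>Gamma\<^esub> a \<otimes>\<^bsub>Gamma\<^esub> inv\<^bsub>Gamma\<^esub> a"
    unfolding a_def b_def Gamma by (simp add: presented_word_mult flip: presented_word_Inv)
  moreover
  have UNIV_gen: "(UNIV :: gen set) = {gen_a, gen_b}"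
    using gen.exhaust by auto
  have "range (\<lambda>x. presented_word R [Gen x]) = {a, b}"
    by (subst UNIV_gen) (simp add: a_def b_def)
  then have "generate Gamma {a, b} = carrier Gamma"
    using presented_group_generated[of R] by (simp add: Gamma)
  ultimately have "marked_affine_group Gamma a b \<phi>"
    using \<phi>(1) \<phi>(2)[of gen_a] \<phi>(2)[of gen_b]
    by unfold_locales (auto simp: a_def b_def f_def Gamma carrier_presented_group)
  then show thesis
    using that by blast
qed

theorem proposition2p4:
  shows "finitely_generated_group Gamma \<and>
    (\<exists>r. isolated_left_ordering Gamma r \<and>
         \<not> finitely_generated_semigroup Gamma (positive_cone Gamma r))"
proof -
  obtain a b \<phi> where "marked_affine_group Gamma a b \<phi>"
    by (rule Gamma_marked)
  then interpret marked_affine_group Gamma a b \<phi> .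
  interpret cone: group_cone Gamma cone
    by (rule group_cone_cone)
  have "finitely_generated_group Gamma"
    unfolding finitely_generated_group_def using is_group generated
    by (intro conjI exI[of _ "{a, b}"]) auto
  moreover have "\<not> finitely_generated_semigroup Gamma (positive_cone Gamma (cone_order Gamma cone))"
    unfolding cone.positive_cone_cone_order by (rule cone_not_finitely_generated)
  ultimately show ?thesis
    using isolated_cone by blast
qed

end
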